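(* Let $A\in\mathbb{R}^{n\times n}$ be an irreducible monotone matrix, let $\mathbf{x}_k>0$ be a vector with $\|\mathbf{x}_k\|=1$ and $\mathbf{x}_k\neq\mathbf{x}$, and let $\gamma_k\in[0,1)$. Suppose $\overline{\lambda}_k>\rho(A^{-1})$, that $\mathbf{y}_{k+1}$ and $\mathbf{f}_k$ satisfy $$(\overline{\lambda}_kA-I)\mathbf{y}_{k+1}=A\mathbf{x}_k+\mathbf{f}_k,\qquad \|\mathbf{f}_k\|\le\gamma_k\,\mathrm{sep}(0,A)\min(\mathbf{x}_k),$$ and set $\mathbf{x}_{k+1}=\mathbf{y}_{k+1}/\|\mathbf{y}_{k+1}\|$ and $$\overline{\lambda}_{k+1}=\overline{\lambda}_k-(1-\gamma_k)\min\left(\frac{\mathbf{x}_k}{\mathbf{y}_{k+1}}\right).$$ Then the new approximation satisfies $\mathbf{x}_{k+1}>0$, and the sequence $\{\overline{\lambda}_k\}$ is monotonically decreasing and bounded below by $\rho(A^{-1})$, i.e. $$\overline{\lambda}_k>\overline{\lambda}_{k+1}\ge\rho(A^{-1}).$$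
   Context: A real square matrix $A$ is monotone if it is nonsingular and $A^{-1}\ge 0$ entrywise. A matrix is reducible if it can be brought to block upper-triangular form by a simultaneous row/column permutation, and irreducible otherwise. $\rho(\cdot)$ is the spectral radius. $\|\cdot\|$ is the 2-norm for vectors and matrices. $\mathrm{sep}(0,A)=\|A^{-1}\|^{-1}$. For a vector $\mathbf{v}$, $\mathbf{v}>0$ means all entries are positive, $\min(\mathbf{v})$ is its smallest entry, and for positive vectors $\mathbf{v},\mathbf{w}$, $\min\left(\frac{\mathbf{w}}{\mathbf{v}}\right)=\min_i \mathbf{w}^{(i)}/\mathbf{v}^{(i)}$. $\mathbf{x}>0$ denotes the unit-length positive eigenvector of $A^{-1}$ for the simple eigenvalue $\rho(A^{-1})$. *)

theory Defs
  imports "HOL-Analysis.Analysis"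
begin

definition nonneg_matrix :: "real ^ 'n ^ 'n \<Rightarrow> bool" where
  "nonneg_matrix A \<longleftrightarrow> (\<forall>i j. 0 \<le> A $ i $ j)"

definition pos_vector :: "real ^ 'n \<Rightarrow> bool" where
  "pos_vector v \<longleftrightarrow> (\<forall>i. 0 < v $ i)"

definition monotone_matrix :: "real ^ 'n ^ 'n \<Rightarrow> bool" where
  "monotone_matrix A \<longleftrightarrow> invertible A \<and> nonneg_matrix (matrix_inv A)"

text \<open>
  The index type carries no order, so a simultaneous permutation of rows and columns is
  an enumeration \<open>p\<close> of the indices by \<open>0, \<dots>, n - 1\<close>. The permuted matrix
  \<open>(i, j) \<mapsto> A $ p i $ p j\<close> is block upper triangular, with square diagonal blocks of
  sizes \<open>r > 0\<close> and \<open>n - r > 0\<close>, when its lower left block vanishes.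
  In particular every \<open>1 \<times> 1\<close> matrix is irreducible, including the zero matrix.
\<close>

definition reducible_matrix :: "real ^ 'n ^ 'n \<Rightarrow> bool" where
  "reducible_matrix A \<longleftrightarrow>
     (\<exists>(p :: nat \<Rightarrow> 'n) r. bij_betw p {..<CARD('n)} UNIV \<and> 0 < r \<and> r < CARD('n) \<and>
        (\<forall>i j. r \<le> i \<longrightarrow> i < CARD('n) \<longrightarrow> j < r \<longrightarrow> A $ p i $ p j = 0))"

definition irreducible_matrix :: "real ^ 'n ^ 'n \<Rightarrow> bool" where
  "irreducible_matrix A \<longleftrightarrow> \<not> reducible_matrix A"

text \<open>The spectrum of a real matrix consists of its complex eigenvalues.\<close>

definition spectrum :: "real ^ 'n ^ 'n \<Rightarrow> complex set" where
  "spectrum A =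
     {\<mu>. \<exists>v :: complex ^ 'n. v \<noteq> 0 \<and> map_matrix complex_of_real A *v v = \<mu> *s v}"

definition spectral_radius :: "real ^ 'n ^ 'n \<Rightarrow> real" where
  "spectral_radius A = Max (cmod ` spectrum A)"

text \<open>
  On \<^typ>\<open>real ^ 'n\<close> the library's \<^const>\<open>norm\<close> is the Euclidean norm, so the operator
  norm is the matrix 2-norm. The library's \<^const>\<open>norm\<close> on \<^typ>\<open>real ^ 'n ^ 'n\<close> is the
  Frobenius norm and would be the wrong choice here.
\<close>

definition matrix_norm2 :: "real ^ 'n ^ 'n \<Rightarrow> real" where
  "matrix_norm2 A = onorm ((*v) A)"

definition sep0 :: "real ^ 'n ^ 'n \<Rightarrow> real" where
  "sep0 A = inverse (matrix_norm2 (matrix_inv A))"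

definition min_entry :: "real ^ 'n \<Rightarrow> real" where
  "min_entry v = Min (range (\<lambda>i. v $ i))"

definition min_ratio :: "real ^ 'n \<Rightarrow> real ^ 'n \<Rightarrow> real" where
  "min_ratio w v = Min (range (\<lambda>i. w $ i / v $ i))"

text \<open>
  Existence and uniqueness of this vector for irreducible monotone \<open>A\<close> is the
  Perron--Frobenius theorem for the nonnegative irreducible matrix \<open>matrix_inv A\<close>.
\<close>

definition perron_vector :: "real ^ 'n ^ 'n \<Rightarrow> real ^ 'n" where
  "perron_vector A =
     (THE x. pos_vector x \<and> norm x = 1 \<and>
             matrix_inv A *v x = spectral_radius (matrix_inv A) *\<^sub>R x)"

end

theory Submission
  imports Defs "HOL-Computational_Algebra.Fundamental_Theorem_Algebra"
begin

text \<open>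
  Put \<open>B = A\<^sup>-\<^sup>1 \<ge> 0\<close>. Applying \<open>B\<close> to the inexact inverse iteration turns it into
  \<open>(\<lambda>\<^sub>k I - B) y = x\<^sub>k + B f\<^sub>k\<close>. The tolerance on \<open>f\<^sub>k\<close> ensures that no entry of
  \<open>B f\<^sub>k\<close> exceeds \<open>\<gamma>\<^sub>k min(x\<^sub>k)\<close> in modulus, so the right-hand side is at least
  \<open>(1 - \<gamma>\<^sub>k) x\<^sub>k > 0\<close>.

  Positivity of \<open>y\<close> is then the statement that \<open>tI - B\<close> has a positive inverse for every \<open>t\<close>
  beyond the spectral radius (\<open>pos_solution_beyond_eigenvalues\<close>). Instead of a Neumann series the
  proof deforms \<open>t\<close>: for \<open>t\<close> above all row sums the solution is positive by diagonal
  dominance; while \<open>t\<close> decreases the solution varies continuously, because no eigenvalue is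
  met; and it cannot leave the positive cone, because a nonnegative solution of
  \<open>t y = B y + b\<close> with \<open>b > 0\<close> has no zero entry. A positive \<open>y\<close> makes
  \<open>min(x\<^sub>k / y)\<close> positive, so the shift strictly decreases.

  For the lower bound, \<open>B y = \<lambda>\<^sub>k y - (x\<^sub>k + B f\<^sub>k) \<le> \<lambda>\<^sub>k y - (1 - \<gamma>\<^sub>k) x\<^sub>k \<le> \<lambda>\<^sub>k\<^sub>+\<^sub>1 y\<close>,
  and a positive \<open>y\<close> with \<open>B y \<le> c y\<close> forces \<open>\<rho>(B) \<le> c\<close> (\<open>spectral_radius_le\<close>, the
  Collatz--Wielandt bound).

  The spectral radius is a maximum over complex eigenvalues. That this maximum is attained rests on
  the spectrum being finite and nonempty, obtained here from the characteristic polynomial.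
\<close>

section \<open>The spectrum of a real matrix\<close>

lemma mat_mult_vec: "mat t *v (x :: 'a::comm_ring_1 ^ 'n) = t *s x"
  by (simp add: vec_eq_iff matrix_vector_mult_def mat_def if_distrib if_distribR cong: if_cong)

lemma continuous_on_det:
  fixes M :: "'b::topological_space \<Rightarrow> 'a::real_normed_field ^ 'n ^ 'n"
  assumes "\<And>i j. continuous_on S (\<lambda>t. M t $ i $ j)"
  shows "continuous_on S (\<lambda>t. det (M t))"
  unfolding det_def by (intro continuous_intros assms)

lemma eigenvalue_iff_det:
  fixes M :: "'a::field ^ 'n ^ 'n"
  shows "(\<exists>v. v \<noteq> 0 \<and> M *v v = z *s v) \<longleftrightarrow> det (mat z - M) = 0"
proof -
  have "det (mat z - M) \<noteq> 0 \<longleftrightarrow> (\<forall>v. (mat z - M) *v v = 0 \<longrightarrow> v = 0)"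
    by (simp flip: invertible_det_nz add: invertible_left_inverse matrix_left_invertible_ker)
  also have "\<dots> \<longleftrightarrow> (\<forall>v. M *v v = z *s v \<longrightarrow> v = 0)"
    by (auto simp: matrix_vector_mult_diff_rdistrib mat_mult_vec)
  finally show ?thesis by blast
qed

lemma in_spectrum_iff_det:
  "z \<in> spectrum A \<longleftrightarrow> det (mat z - map_matrix complex_of_real A) = 0"
  by (simp add: spectrum_def flip: eigenvalue_iff_det)

lemma of_real_det: "complex_of_real (det M) = det (map_matrix complex_of_real M)"
  by (simp add: det_def)

lemma poly_det: "poly (det N) z = det (map_matrix (\<lambda>p. poly p z) N)"
  for N :: "'a::comm_ring_1 poly ^ 'n ^ 'n"
  by (simp add: det_def poly_sum poly_prod)

definition charpoly :: "complex ^ 'n ^ 'n \<Rightarrow> complex poly" where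
  "charpoly M = det (\<chi> i j. [:- M $ i $ j, if i = j then 1 else 0:])"

lemma poly_charpoly: "poly (charpoly M) z = det (mat z - M)"
proof -
  have "map_matrix (\<lambda>p. poly p z) (\<chi> i j. [:- M $ i $ j, if i = j then 1 else 0:]) = mat z - M"
    by (simp add: vec_eq_iff mat_def)
  then show ?thesis by (simp add: charpoly_def poly_det)
qed

text \<open>
  Nonconstancy is read off at infinity: with \<open>z = 1/s\<close> one has
  \<open>det (I - sM) = s\<^sup>n det (zI - M)\<close>, which tends to \<open>1\<close> as \<open>s \<rightarrow> 0\<close>, whereas a constant
  \<open>det (zI - M)\<close> would make it tend to \<open>0\<close>. This single fact excludes the zero
  polynomial, so the spectrum is finite, and nonzero constants, so the spectrum is nonempty.
\<close>

lemma charpoly_not_constant: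
  fixes M :: "complex ^ 'n ^ 'n"
  shows "\<not> constant (poly (charpoly M))"
proof
  assume "constant (poly (charpoly M))"
  then obtain c where c: "\<And>z. det (mat z - M) = c"
    unfolding constant_def poly_charpoly by blast
  define D where "D s = det (\<chi> i j. (if i = j then 1 else 0) - s * M $ i $ j)" for s
  have D: "D s = s ^ CARD('n) * c" if "s \<noteq> 0" for s
  proof -
    have "(\<chi> i j. (if i = j then 1 else 0) - s * M $ i $ j) = (\<chi> i. s *s (mat (1 / s) - M) $ i)"
      using that by (simp add: vec_eq_iff mat_def algebra_simps)
    then have "D s = det (\<chi> i. s *s (mat (1 / s) - M) $ i)"
      by (simp only: D_def)
    also have "\<dots> = s ^ CARD('n) * det (mat (1 / s) - M)"
      unfolding det_rows_mul by (simp flip: vector_minus_component)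
    finally show ?thesis by (simp add: c)
  qed
  have "isCont D 0"
    unfolding D_def det_def by (auto intro!: continuous_intros)
  then have "D \<midarrow>0\<rightarrow> D 0"
    by (simp add: isCont_def)
  moreover have "D 0 = det (mat 1 :: complex ^ 'n ^ 'n)"
    unfolding D_def by (intro arg_cong[where f = det]) (simp add: vec_eq_iff mat_def)
  ultimately have "D \<midarrow>0\<rightarrow> 1"
    by simp
  moreover have "(\<lambda>s. s ^ CARD('n) * c) \<midarrow>0\<rightarrow> 0 ^ CARD('n) * c"
    by (intro tendsto_intros)
  then have "D \<midarrow>0\<rightarrow> 0 ^ CARD('n) * c"
    by (rule Lim_transform_eventually) (auto simp: eventually_at_filter D)
  then have "D \<midarrow>0\<rightarrow> 0"
    by (simp add: power_0_left)
  ultimately show False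
    using tendsto_unique[of "at (0::complex)" D 1 0] by simp
qed

lemma spectrum_eq_roots: "spectrum A = {z. poly (charpoly (map_matrix complex_of_real A)) z = 0}"
  by (auto simp: in_spectrum_iff_det poly_charpoly)

lemma finite_spectrum: "finite (spectrum A)"
proof -
  have "charpoly (map_matrix complex_of_real A) \<noteq> 0"
    using charpoly_not_constant[of "map_matrix complex_of_real A"] by (auto simp: constant_def)
  then show ?thesis unfolding spectrum_eq_roots by (rule poly_roots_finite)
qed

lemma spectrum_nonempty: "spectrum A \<noteq> {}"
  using fundamental_theorem_of_algebra[OF charpoly_not_constant] by (auto simp: spectrum_eq_roots)

lemma spectral_radius_attained:
  obtains z where "z \<in> spectrum A" "cmod z = spectral_radius A"
proof -
  have "spectral_radius A \<in> cmod ` spectrum A"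
    unfolding spectral_radius_def
    by (intro Max_in) (auto simp: finite_spectrum spectrum_nonempty)
  then show ?thesis using that by auto
qed

lemma det_nonzero_beyond_spectral_radius:
  assumes "spectral_radius A < t"
  shows "det (mat t - A) \<noteq> 0"
proof
  assume "det (mat t - A) = 0"
  then have "det (map_matrix complex_of_real (mat t - A)) = 0"
    by (simp flip: of_real_det)
  moreover have "map_matrix complex_of_real (mat t - A)
      = mat (complex_of_real t) - map_matrix complex_of_real A"
    by (simp add: vec_eq_iff mat_def)
  ultimately have "complex_of_real t \<in> spectrum A"
    by (simp add: in_spectrum_iff_det)
  then have "cmod (complex_of_real t) \<le> spectral_radius A"
    unfolding spectral_radius_def by (intro Max_ge imageI) (simp_all add: finite_spectrum)
  with assms show False by simp
qed

section \<open>Nonnegative matrices\<close>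

text \<open>
  Measure an eigenvector \<open>v\<close> for an eigenvalue of maximal modulus in the norm
  \<open>max\<^sub>i |v\<^sub>i| / y\<^sub>i\<close>: the hypothesis says that \<open>B\<close> has operator norm at most \<open>c\<close> for it.
\<close>

lemma spectral_radius_le:
  assumes B: "nonneg_matrix B" and y: "pos_vector y" and le: "\<And>i. (B *v y) $ i \<le> c * y $ i"
  shows "spectral_radius B \<le> c"
proof -
  obtain z where z: "z \<in> spectrum B" "cmod z = spectral_radius B"
    by (rule spectral_radius_attained)
  then obtain v where v: "v \<noteq> 0" "map_matrix complex_of_real B *v v = z *s v"
    by (auto simp: spectrum_def)
  have ypos: "0 < y $ i" for i
    using y by (simp add: pos_vector_def)
  define q where "q i = cmod (v $ i) / y $ i" for i
  define m where "m = Max (range q)"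
  have "m \<in> range q"
    unfolding m_def by (intro Max_in) auto
  then obtain i where i: "m = q i" by auto
  have qm: "q j \<le> m" for j
    unfolding m_def by (intro Max_ge) auto
  have vm: "cmod (v $ j) \<le> m * y $ j" for j
    using qm[of j] ypos[of j] by (simp add: q_def pos_divide_le_eq)
  have vi: "cmod (v $ i) = m * y $ i"
    using ypos[of i] by (simp add: i q_def)
  obtain j where "v $ j \<noteq> 0" using v(1) by (auto simp: vec_eq_iff)
  then have "0 < q j" using ypos[of j] by (simp add: q_def)
  then have m: "0 < m" using qm[of j] by simp
  have "z * v $ i = (\<Sum>j\<in>UNIV. complex_of_real (B $ i $ j) * v $ j)"
    using arg_cong[OF v(2), of "\<lambda>u. u $ i"] by (simp add: matrix_vector_mult_def)
  then have "cmod z * cmod (v $ i) = cmod (\<Sum>j\<in>UNIV. complex_of_real (B $ i $ j) * v $ j)"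
    by (simp flip: norm_mult)
  also have "\<dots> \<le> (\<Sum>j\<in>UNIV. B $ i $ j * (m * y $ j))"
    using B vm by (intro sum_norm_le) (auto simp: norm_mult nonneg_matrix_def intro!: mult_mono)
  also have "\<dots> = m * (B *v y) $ i"
    by (simp add: matrix_vector_mult_def sum_distrib_left algebra_simps)
  also have "\<dots> \<le> m * (c * y $ i)"
    using le[of i] m by simp
  finally have "cmod z * (m * y $ i) \<le> c * (m * y $ i)"
    by (simp add: vi algebra_simps)
  then show ?thesis
    using m ypos[of i] z(2) by (simp add: mult_le_cancel_right)
qed

text \<open>Compare both sides of the equation in the row where \<open>y\<close> is smallest.\<close>

lemma pos_solution_beyond_row_sums:
  assumes B: "nonneg_matrix B" and b: "pos_vector b"
    and row: "\<And>i. (\<Sum>j\<in>UNIV. B $ i $ j) < t"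
    and eq: "(mat t - B) *v y = b"
  shows "pos_vector y"
proof -
  have "Min (range (\<lambda>i. y $ i)) \<in> range (\<lambda>i. y $ i)"
    by (intro Min_in) auto
  then obtain i where i: "y $ i = Min (range (\<lambda>i. y $ i))" by (metis imageE)
  have ymin: "y $ i \<le> y $ j" for j
    unfolding i by (intro Min_le) auto
  have "t * y $ i - (\<Sum>j\<in>UNIV. B $ i $ j * y $ j) = b $ i"
    using arg_cong[OF eq, of "\<lambda>u. u $ i"]
    by (simp add: matrix_vector_mult_diff_rdistrib mat_mult_vec) (simp add: matrix_vector_mult_def)
  moreover have "(\<Sum>j\<in>UNIV. B $ i $ j * y $ i) \<le> (\<Sum>j\<in>UNIV. B $ i $ j * y $ j)"
    using B ymin by (intro sum_mono mult_left_mono) (auto simp: nonneg_matrix_def)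
  ultimately have "b $ i \<le> (t - (\<Sum>j\<in>UNIV. B $ i $ j)) * y $ i"
    by (simp add: sum_distrib_right left_diff_distrib)
  moreover have "0 < b $ i" using b by (simp add: pos_vector_def)
  ultimately have "0 < (t - (\<Sum>j\<in>UNIV. B $ i $ j)) * y $ i"
    by linarith
  then have "0 < y $ i"
    using row[of i] by (simp add: zero_less_mult_iff)
  then show ?thesis
    using ymin less_le_trans unfolding pos_vector_def by blast
qed

text \<open>
  The solution cannot touch the boundary of the positive cone: where \<open>y\<close> has a zero entry, the
  equation would read \<open>0 = (B y)\<^sub>i + b\<^sub>i > 0\<close>.
\<close>

lemma pos_solution_if_nonneg_solution:
  assumes B: "nonneg_matrix B" and b: "pos_vector b"
    and eq: "(mat t - B) *v y = b" and y: "\<And>i. 0 \<le> y $ i"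
  shows "pos_vector y"
  unfolding pos_vector_def
proof
  fix i
  have "t * y $ i = (\<Sum>j\<in>UNIV. B $ i $ j * y $ j) + b $ i"
    using arg_cong[OF eq, of "\<lambda>u. u $ i"]
    by (simp add: matrix_vector_mult_diff_rdistrib mat_mult_vec) (simp add: matrix_vector_mult_def)
  moreover have "0 \<le> (\<Sum>j\<in>UNIV. B $ i $ j * y $ j)"
    using B y by (intro sum_nonneg) (auto simp: nonneg_matrix_def)
  moreover have "0 < b $ i" using b by (simp add: pos_vector_def)
  ultimately have "0 < t * y $ i" by linarith
  then show "0 < y $ i"
    using y[of i] by (auto simp: zero_less_mult_iff)
qed

text \<open>
  On an interval from \<open>s\<close> to a value above all row sums, the set of parameters with a positive
  solution is open because positivity is an open condition, closed because there positivity and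
  nonnegativity coincide, and it contains the right end point; so it is the whole interval.
  Cramer's rule supplies the continuity of the solution.
\<close>

lemma pos_solution_beyond_eigenvalues:
  fixes B :: "real ^ 'n ^ 'n"
  assumes B: "nonneg_matrix B" and b: "pos_vector b"
    and det: "\<And>t. s \<le> t \<Longrightarrow> det (mat t - B) \<noteq> 0"
    and eq: "(mat s - B) *v y = b"
  shows "pos_vector y"
proof -
  \<comment> \<open>Exceeds \<open>s\<close> and, as the entries of \<open>B\<close> are nonnegative, every row sum.\<close>
  define T where "T = max s ((\<Sum>i\<in>UNIV. \<Sum>j\<in>UNIV. B $ i $ j) + 1)"
  define Y where
    "Y t = (\<chi> k. det (\<chi> i j. if j = k then b $ i else (mat t - B) $ i $ j) / det (mat t - B))" for t
  have Y: "(mat t - B) *v Y t = b" if "s \<le> t" for t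
    using cramer[OF det[OF that], of "Y t" b] by (simp add: Y_def)
  have shift: "continuous_on {s..T} (\<lambda>t. (mat t - B) $ i $ j)" for i j
    by (cases "i = j") (auto simp: mat_def intro!: continuous_intros)
  have "continuous_on {s..T} (\<lambda>t. det (\<chi> i j. if j = k then b $ i else (mat t - B) $ i $ j))" for k
  proof (rule continuous_on_det)
    fix i j
    show "continuous_on {s..T} (\<lambda>t. (\<chi> i j. if j = k then b $ i else (mat t - B) $ i $ j) $ i $ j)"
      using shift[of i j] by (cases "j = k") (simp_all del: vector_minus_component)
  qed
  moreover have "continuous_on {s..T} (\<lambda>t. det (mat t - B))"
    by (intro continuous_on_det shift)
  ultimately have cont: "continuous_on {s..T} Y"
    unfolding Y_def using det by (intro continuous_intros) auto
  define P where "P = {s..T} \<inter> Y -` {u. \<forall>i. 0 < u $ i}"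
  have "open {u :: real ^ 'n. \<forall>i. 0 < u $ i}"
  proof -
    have "open (\<Inter>i. {u :: real ^ 'n. 0 < u $ i})"
      by (intro open_INT) (auto intro!: open_Collect_less continuous_intros)
    then show ?thesis by (simp add: Collect_all_eq)
  qed
  then have op: "openin (top_of_set {s..T}) P"
    unfolding P_def by (rule continuous_openin_preimage_gen[OF cont])
  have "P = {s..T} \<inter> Y -` {u. \<forall>i. 0 \<le> u $ i}"
    using pos_solution_if_nonneg_solution[OF B b Y]
    by (auto simp: P_def pos_vector_def less_imp_le)
  moreover have "closed {u :: real ^ 'n. \<forall>i. 0 \<le> u $ i}"
    by (intro closed_Collect_all closed_Collect_le continuous_intros)
  ultimately have cl: "closedin (top_of_set {s..T}) P"
    by (simp only: continuous_closedin_preimage[OF cont])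
  have "T \<in> P"
  proof -
    have "(\<Sum>j\<in>UNIV. B $ i $ j) < T" for i
    proof -
      have "(\<Sum>j\<in>UNIV. B $ i $ j) \<le> (\<Sum>i\<in>UNIV. \<Sum>j\<in>UNIV. B $ i $ j)"
        using B by (intro member_le_sum sum_nonneg) (auto simp: nonneg_matrix_def)
      then show ?thesis by (simp add: T_def)
    qed
    then have "pos_vector (Y T)"
      using Y[of T] by (intro pos_solution_beyond_row_sums[OF B b]) (auto simp: T_def)
    then show ?thesis by (simp add: P_def pos_vector_def T_def)
  qed
  with op cl have "P = {s..T}"
    using connected_clopen[THEN iffD1, OF connected_Icc, rule_format, of s T P] by blast
  then have "pos_vector (Y s)"
    by (auto simp: P_def pos_vector_def T_def)
  moreover have "y = Y s"
    using cramer[OF det[of s], of y b] eq by (simp add: Y_def)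
  ultimately show ?thesis by simp
qed

section \<open>The inexact Noda iteration\<close>

lemma matrix_inv_mult_left:
  fixes A :: "'a::semiring_1 ^ 'n ^ 'm"
  assumes "invertible A"
  shows "matrix_inv A ** A = mat 1"
  using someI_ex[OF assms[unfolded invertible_def]] by (simp add: matrix_inv_def)

text \<open>
  The separation \<open>sep(0, A)\<close> is the reciprocal of the norm of \<open>A\<^sup>-\<^sup>1\<close>, so it cancels the
  amplification of the residual by \<open>A\<^sup>-\<^sup>1\<close>.
\<close>

lemma norm_inv_residual_le:
  assumes f: "norm f \<le> c * sep0 A" and "0 \<le> c"
  shows "norm (matrix_inv A *v f) \<le> c"
proof -
  let ?N = "matrix_norm2 (matrix_inv A)"
  have "0 \<le> ?N"
    unfolding matrix_norm2_def by (intro onorm_pos_le) simp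
  have "norm (matrix_inv A *v f) \<le> ?N * norm f"
    unfolding matrix_norm2_def by (intro onorm) simp
  also have "\<dots> \<le> ?N * (c * inverse ?N)"
    using f \<open>0 \<le> ?N\<close> by (intro mult_left_mono) (auto simp: sep0_def)
  \<comment> \<open>An inequality only, since \<open>inverse 0 = 0\<close>.\<close>
  also have "\<dots> \<le> c"
    using \<open>0 \<le> c\<close> by (cases "?N = 0") (auto simp: field_simps)
  finally show ?thesis .
qed

lemma min_entry_le: "min_entry v \<le> v $ i"
  unfolding min_entry_def by (intro Min_le) auto

lemma min_entry_pos: "pos_vector v \<Longrightarrow> 0 < min_entry v"
  unfolding min_entry_def pos_vector_def by (subst Min_gr_iff) auto

lemma min_ratio_le: "min_ratio w v \<le> w $ i / v $ i"
  unfolding min_ratio_def by (intro Min_le) auto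

lemma min_ratio_pos: "pos_vector w \<Longrightarrow> pos_vector v \<Longrightarrow> 0 < min_ratio w v"
  unfolding min_ratio_def pos_vector_def by (subst Min_gr_iff) auto

theorem lemma3:
  fixes A :: "real ^ 'n ^ 'n"
    and x y f :: "nat \<Rightarrow> real ^ 'n"
    and \<gamma> lam :: "nat \<Rightarrow> real"
    and k :: nat
  assumes "irreducible_matrix A"
    and "monotone_matrix A"
    and "pos_vector (x k)"
    and "norm (x k) = 1"
    and "x k \<noteq> perron_vector A"
    and "0 \<le> \<gamma> k" and "\<gamma> k < 1"
    and "lam k > spectral_radius (matrix_inv A)"
    and "(lam k *\<^sub>R A - mat 1) *v y (Suc k) = A *v x k + f k"
    and "norm (f k) \<le> \<gamma> k * sep0 A * min_entry (x k)"
    and "x (Suc k) = y (Suc k) /\<^sub>R norm (y (Suc k))"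
    and "lam (Suc k) = lam k - (1 - \<gamma> k) * min_ratio (x k) (y (Suc k))"
  shows "pos_vector (x (Suc k)) \<and> lam k > lam (Suc k) \<and>
         lam (Suc k) \<ge> spectral_radius (matrix_inv A)"
proof -
  define B where "B = matrix_inv A"
  define Y where "Y = y (Suc k)"
  define b where "b = x k + B *v f k"
  have B: "nonneg_matrix B" and BA: "B ** A = mat 1"
    using assms(2) by (auto simp: monotone_matrix_def B_def matrix_inv_mult_left)
  have xpos: "0 < x k $ i" for i
    using assms(3) by (simp add: pos_vector_def)

  have "norm (B *v f k) \<le> \<gamma> k * min_entry (x k)"
    unfolding B_def using assms(6,10) min_entry_pos[OF assms(3)]
    by (intro norm_inv_residual_le) (auto simp: algebra_simps)
  then have Bf: "\<bar>(B *v f k) $ i\<bar> \<le> \<gamma> k * x k $ i" for i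
    using component_le_norm_cart[of "B *v f k" i]
      mult_left_mono[OF min_entry_le[of "x k" i] assms(6)] by linarith
  have b_ge: "(1 - \<gamma> k) * x k $ i \<le> b $ i" for i
    using Bf[of i] by (simp add: b_def left_diff_distrib abs_le_iff)
  have bpos: "pos_vector b"
    unfolding pos_vector_def
  proof
    fix i
    have "0 < (1 - \<gamma> k) * x k $ i" using assms(7) xpos[of i] by simp
    then show "0 < b $ i" using b_ge[of i] by linarith
  qed

  have "B *v ((lam k *\<^sub>R A - mat 1) *v Y) = B *v (A *v x k + f k)"
    using assms(9) by (simp add: Y_def)
  then have eq: "lam k *\<^sub>R Y - B *v Y = b"
    by (simp add: b_def matrix_vector_mult_diff_rdistrib scaleR_matrix_vector_assoc[symmetric]
        matrix_vector_mult_diff_distrib matrix_vector_right_distrib matrix_vector_mult_scaleR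
        matrix_vector_mul_assoc BA)
  then have "(mat (lam k) - B) *v Y = b"
    by (simp add: matrix_vector_mult_diff_rdistrib mat_mult_vec scalar_mult_eq_scaleR)
  moreover have "det (mat t - B) \<noteq> 0" if "lam k \<le> t" for t
    using that assms(8) by (intro det_nonzero_beyond_spectral_radius) (simp add: B_def)
  ultimately have Y: "pos_vector Y"
    by (intro pos_solution_beyond_eigenvalues[OF B bpos])
  then have Ypos: "0 < Y $ i" for i
    by (simp add: pos_vector_def)

  have "Y \<noteq> 0"
    using Ypos by (metis less_irrefl zero_index)
  then have xnew: "pos_vector (x (Suc k))"
    using Ypos assms(11) by (simp add: pos_vector_def Y_def[symmetric])

  have decr: "lam (Suc k) < lam k"
    using min_ratio_pos[OF assms(3) Y] assms(7) by (simp add: assms(12) Y_def[symmetric])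

  have "(B *v Y) $ i \<le> lam (Suc k) * Y $ i" for i
  proof -
    have "min_ratio (x k) Y * Y $ i \<le> x k $ i"
      using min_ratio_le[of "x k" Y i] Ypos[of i] by (simp add: pos_le_divide_eq)
    then have "(1 - \<gamma> k) * (min_ratio (x k) Y * Y $ i) \<le> (1 - \<gamma> k) * x k $ i"
      using assms(7) by (intro mult_left_mono) auto
    moreover have "lam k * Y $ i - (B *v Y) $ i = b $ i"
      using arg_cong[OF eq, of "\<lambda>u. u $ i"] by simp
    moreover have "lam (Suc k) * Y $ i = lam k * Y $ i - (1 - \<gamma> k) * (min_ratio (x k) Y * Y $ i)"
      by (simp add: assms(12) Y_def algebra_simps)
    ultimately show ?thesis
      using b_ge[of i] by linarith
  qed
  then have "spectral_radius B \<le> lam (Suc k)"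
    by (rule spectral_radius_le[OF B Y])
  with xnew decr show ?thesis by (simp add: B_def)
qed

end
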